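(* Let $\mathcal{H}$ be a separable complex Hilbert space with open unit ball $B$. Let $f:B \to B$ be a holomorphic mapping, let $p \in B$, and let $M_p$ be a Möbius transformation of the ball $B$ sending $p$ to the origin. Suppose that $f(p)=p$ and that there is a unitary operator $U$ on $\mathcal{H}$ such that (i) $U \circ d[M_p]|_p \circ df_p \circ d[M_p^{-1}]|_0$ is triangularizable, and (ii) the spectrum $\sigma(U \circ d[M_p]|_p \circ df_p \circ d[M_p^{-1}]|_0)$ lies in the unit circle in $\mathbb{C}$. Then $f$ is an automorphism of $B$.
   Context: A Möbius transformation of $B$ is a biholomorphic mapping of $B$ onto itself, and an automorphism of $B$ is likewise a biholomorphic mapping of $B$ onto itself. For a holomorphic mapping $g$ between domains in $\mathcal{H}$, the differential at a point $q$, written $dg_q$ or $d[g]|_q$, is the bounded linear operator on $\mathcal{H}$ given by $v\mapsto \lim_{\mathbb{C}\ni h \to 0} \frac{g(q+hv)-g(q)}{h}$. For a bounded linear operator $T$ on $\mathcal{H}$, $\sigma(T) = \{\lambda\in\mathbb{C} : T-\lambda I \text{ is not invertible}\}$. A bounded linear operator $T:\mathcal{H}\to\mathcal{H}$ is called triangularizable if there exists a basis $\{e_1,e_2,\ldots\}$ of $\mathcal{H}$ such that $T(\mathbb{C}e_1+\cdots+\mathbb{C}e_N)\subset \mathbb{C}e_1+\cdots+\mathbb{C}e_N$ for every positive integer $N$; the basis can always be taken to be orthonormal (the Gram-Schmidt process preserves the flags $\mathbb{C}e_1+\cdots+\mathbb{C}e_N$). *)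

theory Defs
  imports "HOL-Analysis.Analysis"
begin

text \<open>
  The library has no complex normed or inner product spaces. A complex Hilbert space is
  represented as a complete real inner product space that carries a compatible complex scalar
  multiplication and a complex inner product (linear in its first argument) whose real part is
  the real inner product; positive definiteness of \<open>cinner\<close>, and the fact that it induces the
  norm, are inherited from \<^class>\<open>real_inner\<close>. Dimension is not restricted.
\<close>

class complex_hilbert_space = real_inner + banach +
  fixes scaleC :: "complex \<Rightarrow> 'a \<Rightarrow> 'a" (infixr "*\<^sub>C" 75)
    and cinner :: "'a \<Rightarrow> 'a \<Rightarrow> complex"
  assumes scaleC_add_right: "c *\<^sub>C (x + y) = c *\<^sub>C x + c *\<^sub>C y"
    and scaleC_add_left: "(c + d) *\<^sub>C x = c *\<^sub>C x + d *\<^sub>C x"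
    and scaleC_scaleC: "c *\<^sub>C (d *\<^sub>C x) = (c * d) *\<^sub>C x"
    and scaleC_one: "1 *\<^sub>C x = x"
    and scaleC_of_real: "complex_of_real r *\<^sub>C x = r *\<^sub>R x"
    and cinner_commute: "cinner x y = cnj (cinner y x)"
    and cinner_add_left: "cinner (x + y) z = cinner x z + cinner y z"
    and cinner_scaleC_left: "cinner (c *\<^sub>C x) y = c * cinner x y"
    and Re_cinner: "Re (cinner x y) = inner x y"

global_interpretation complex_vec:
  vector_space "scaleC :: complex \<Rightarrow> 'a \<Rightarrow> 'a :: complex_hilbert_space"
  defines cspan = complex_vec.span
  by unfold_locales
    (simp_all add: scaleC_add_right scaleC_add_left scaleC_scaleC scaleC_one)


subsection \<open>Bounded operators\<close>

definition bounded_clinear ::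
  "('a::complex_hilbert_space \<Rightarrow> 'a) \<Rightarrow> bool" where
  "bounded_clinear T \<longleftrightarrow> bounded_linear T \<and> (\<forall>c x. T (c *\<^sub>C x) = c *\<^sub>C T x)"

definition unitary :: "('a::complex_hilbert_space \<Rightarrow> 'a) \<Rightarrow> bool" where
  "unitary U \<longleftrightarrow> bounded_clinear U \<and> surj U \<and> (\<forall>x y. cinner (U x) (U y) = cinner x y)"

definition invertible_operator :: "('a::complex_hilbert_space \<Rightarrow> 'a) \<Rightarrow> bool" where
  "invertible_operator T \<longleftrightarrow> (\<exists>S. bounded_clinear S \<and> S \<circ> T = id \<and> T \<circ> S = id)"

definition spectrum :: "('a::complex_hilbert_space \<Rightarrow> 'a) \<Rightarrow> complex set" where
  "spectrum T = {z. \<not> invertible_operator (\<lambda>x. T x - z *\<^sub>C x)}"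

text \<open>
  A basis is a Schauder basis, not necessarily orthogonal, indexed from \<open>0\<close>. The index set is
  all of \<open>\<nat>\<close> if the space is infinite-dimensional, and \<open>{..<d}\<close> if it has dimension \<open>d\<close>; in the
  latter case the expansion below is a finite sum.
\<close>

definition hilbert_basis ::
  "nat set \<Rightarrow> (nat \<Rightarrow> 'a::complex_hilbert_space) \<Rightarrow> bool" where
  "hilbert_basis I e \<longleftrightarrow>
     (I = UNIV \<or> (\<exists>d. I = {..<d})) \<and>
     (\<forall>x. \<exists>!c :: nat \<Rightarrow> complex. (\<forall>n. n \<notin> I \<longrightarrow> c n = 0) \<and> (\<lambda>n. c n *\<^sub>C e n) sums x)"

definition triangularizable :: "('a::complex_hilbert_space \<Rightarrow> 'a) \<Rightarrow> bool" where
  "triangularizable T \<longleftrightarrow>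
     (\<exists>I e. hilbert_basis I e \<and>
        (\<forall>N. T ` cspan (e ` (I \<inter> {..N})) \<subseteq> cspan (e ` (I \<inter> {..N}))))"


subsection \<open>Holomorphic mappings\<close>

abbreviation unit_ball :: "'a::complex_hilbert_space set" where
  "unit_ball \<equiv> ball 0 1"

text \<open>
  Holomorphy on an open set means complex Frechet differentiability at each of its points. Mappings
  between subsets are total functions, of which only the values on the relevant set matter.
\<close>

definition holomorphic_map_on ::
  "('a::complex_hilbert_space \<Rightarrow> 'a) \<Rightarrow> 'a set \<Rightarrow> bool" where
  "holomorphic_map_on g S \<longleftrightarrow>
     (\<forall>q\<in>S. \<exists>D. bounded_clinear D \<and> (g has_derivative D) (at q))"

definition cdifferential ::
  "('a::complex_hilbert_space \<Rightarrow> 'a) \<Rightarrow> 'a \<Rightarrow> 'a \<Rightarrow> 'a" where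
  "cdifferential g q v = Lim (at (0::complex)) (\<lambda>h. (1 / h) *\<^sub>C (g (q + h *\<^sub>C v) - g q))"

definition biholomorphic_self_map ::
  "('a::complex_hilbert_space \<Rightarrow> 'a) \<Rightarrow> 'a set \<Rightarrow> bool" where
  "biholomorphic_self_map g S \<longleftrightarrow>
     bij_betw g S S \<and> holomorphic_map_on g S \<and> holomorphic_map_on (inv_into S g) S"

end

theory Submission
  imports Defs "HOL-Complex_Analysis.Conformal_Mappings"
begin

text \<open>
  Put \<open>h = U \<circ> M \<circ> f \<circ> M\<inverse>\<close>, a holomorphic self-map of the ball with \<open>h 0 = 0\<close> and differential
  \<open>T\<close> at \<open>0\<close>. The Schwarz lemma, applied to the functions \<open>z \<mapsto> \<langle>h (z x), y\<rangle>\<close>, shows that \<open>T\<close> is a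
  contraction. Orthonormalise the flag that triangularises \<open>T\<close>: the diagonal entries are eigenvalues,
  hence unimodular, so a contraction leaves no room for entries above the diagonal. Thus \<open>T\<close> is
  isometric on a dense subspace, hence everywhere. For a unit vector \<open>x\<close> the function
  \<open>z \<mapsto> \<langle>h (z x), T x\<rangle>\<close> is then extremal in the Schwarz lemma, which forces \<open>h = T\<close> on the ball.
  As \<open>0\<close> is not in the spectrum, \<open>T\<close> is invertible, and \<open>M\<inverse> \<circ> T\<inverse> \<circ> U \<circ> M\<close> is the inverse of \<open>f\<close>.
\<close>

section \<open>Complex inner products\<close>

lemma cinner_add_right: "cinner x (y + z) = cinner x y + cinner x z"
  by (metis cinner_add_left cinner_commute complex_cnj_add)

lemma cinner_scaleC_right: "cinner x (c *\<^sub>C y) = cnj c * cinner x y"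
  by (metis cinner_scaleC_left cinner_commute complex_cnj_mult)

lemma cinner_zero_left [simp]: "cinner 0 x = 0"
  using cinner_add_left[of 0 0 x] by simp

lemma cinner_zero_right [simp]: "cinner x 0 = 0"
  using cinner_add_right[of x 0 0] by simp

lemma cinner_diff_left: "cinner (x - y) z = cinner x z - cinner y z"
  using cinner_add_left[of "x - y" y z] by simp

lemma cinner_sum_left: "cinner (\<Sum>i\<in>A. g i) y = (\<Sum>i\<in>A. cinner (g i) y)"
  by (induction A rule: infinite_finite_induct) (auto simp: cinner_add_left)

lemma cinner_self: "cinner x x = of_real ((norm x)\<^sup>2)"
proof (rule complex_eqI)
  show "Re (cinner x x) = Re (of_real ((norm x)\<^sup>2))"
    by (simp add: Re_cinner power2_norm_eq_inner)
  have "Im (cinner x x) = - Im (cinner x x)"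
    by (metis cinner_commute cnj.sel(2))
  then show "Im (cinner x x) = Im (of_real ((norm x)\<^sup>2))"
    by simp
qed

lemma norm_scaleC: "norm (c *\<^sub>C x) = cmod c * norm x"
proof -
  have "of_real ((norm (c *\<^sub>C x))\<^sup>2) = cinner (c *\<^sub>C x) (c *\<^sub>C x)"
    by (rule cinner_self[symmetric])
  also have "\<dots> = (c * cnj c) * cinner x x"
    by (simp add: cinner_scaleC_left cinner_scaleC_right mult.assoc)
  also have "\<dots> = of_real ((cmod c * norm x)\<^sup>2)"
    by (simp add: cinner_self complex_norm_square[symmetric] power_mult_distrib)
  finally have "(norm (c *\<^sub>C x))\<^sup>2 = (cmod c * norm x)\<^sup>2"
    using of_real_eq_iff by blast
  then show ?thesis
    by (simp add: power2_eq_iff_nonneg)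
qed

text \<open>Multiplying \<open>x\<close> by a unimodular phase makes the inner product real and
  nonnegative, so the real Cauchy-Schwarz inequality applies.\<close>

lemma cmod_cinner_le: "cmod (cinner x y) \<le> norm x * norm y"
proof (cases "cinner x y = 0")
  case False
  define c where "c = cnj (sgn (cinner x y))"
  have c: "cmod c = 1"
    using False by (simp add: c_def norm_sgn)
  have "c * cinner x y = of_real (cmod (cinner x y))"
    using False unfolding c_def
    by (simp add: sgn_div_norm scaleR_conv_of_real complex_norm_square[symmetric] field_simps
        power2_eq_square)
  then have "cmod (cinner x y) = Re (cinner (c *\<^sub>C x) y)"
    by (simp add: cinner_scaleC_left)
  also have "\<dots> \<le> norm (c *\<^sub>C x) * norm y"
    by (simp add: Re_cinner norm_cauchy_schwarz)
  finally show ?thesis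
    by (simp add: norm_scaleC c)
qed simp

lemma bounded_linear_cinner_left: "bounded_linear (\<lambda>x. cinner x y)"
proof (rule bounded_linear_intro[where K = "norm y"])
  fix r x
  show "cinner (r *\<^sub>R x) y = r *\<^sub>R cinner x y"
    by (simp add: scaleC_of_real[symmetric] cinner_scaleC_left scaleR_conv_of_real)
qed (simp_all add: cinner_add_left cmod_cinner_le)

lemma bounded_linear_scaleC_left: "bounded_linear (\<lambda>c. c *\<^sub>C x)"
proof (rule bounded_linear_intro[where K = "norm x"])
  fix r c
  show "(r *\<^sub>R c) *\<^sub>C x = r *\<^sub>R (c *\<^sub>C x)"
    by (simp add: scaleR_conv_of_real scaleC_of_real[symmetric] scaleC_scaleC)
qed (simp_all add: scaleC_add_left norm_scaleC)

text \<open>Turns bounds on scalar functions from the Schwarz lemma into bounds on vectors; the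
  normalised \<open>x\<close> is the test vector that attains the norm.\<close>

lemma norm_le_if_cinner_le:
  assumes "\<And>y. norm y = 1 \<Longrightarrow> cmod (cinner x y) \<le> r" and "0 \<le> r"
  shows "norm x \<le> r"
proof (cases "x = 0")
  case False
  let ?y = "of_real (1 / norm x) *\<^sub>C x"
  have "norm ?y = 1"
    using False by (simp add: norm_scaleC norm_divide)
  moreover have "cinner x ?y = of_real (norm x)"
    using False by (simp add: cinner_scaleC_right cinner_self power2_eq_square)
  ultimately show ?thesis
    using assms(1)[of ?y] by simp
qed (use assms in simp)

lemma cinner_span_right_eq_0:
  assumes "v \<in> cspan S" and "\<And>s. s \<in> S \<Longrightarrow> cinner u s = 0"
  shows "cinner u v = 0"
  using assms(1)
proof (induction rule: complex_vec.span_induct)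
  case base
  show ?case
    by (rule complex_vec.subspaceI) (auto simp: cinner_add_right cinner_scaleC_right)
qed (fact assms(2))

section \<open>Bounded operators\<close>

lemma bounded_clinearD:
  assumes "bounded_clinear T"
  shows "bounded_linear T" "T (c *\<^sub>C x) = c *\<^sub>C T x" "T (x + y) = T x + T y"
    "T (x - y) = T x - T y" "T 0 = 0"
  using assms by (auto simp: bounded_clinear_def linear_simps)

lemma bounded_clinear_compose:
  "bounded_clinear S \<Longrightarrow> bounded_clinear T \<Longrightarrow> bounded_clinear (S \<circ> T)"
  by (auto simp: bounded_clinear_def bounded_linear_compose o_def)

lemma bounded_clinear_diff_scaleC:
  fixes T :: "'a::complex_hilbert_space \<Rightarrow> 'a"
  assumes "bounded_clinear T"
  shows "bounded_clinear (\<lambda>x. T x - c *\<^sub>C x)"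
proof -
  have "bounded_linear (\<lambda>x::'a. c *\<^sub>C x)"
  proof (rule bounded_linear_intro[where K = "cmod c"])
    fix r and x :: 'a
    show "c *\<^sub>C (r *\<^sub>R x) = r *\<^sub>R (c *\<^sub>C x)"
      by (simp add: scaleC_of_real[symmetric] scaleC_scaleC mult.commute)
  qed (simp_all add: scaleC_add_right norm_scaleC)
  then show ?thesis
    using assms unfolding bounded_clinear_def
    by (auto intro: bounded_linear_sub
        simp: complex_vec.scale_right_diff_distrib scaleC_scaleC mult.commute)
qed

lemma unitary_norm: "unitary U \<Longrightarrow> norm (U x) = norm x"
  by (metis unitary_def Re_cinner norm_eq_sqrt_inner)

section \<open>Triangularizable contractions with unimodular spectrum\<close>

text \<open>The invariant carried up the flag. An unordered set suffices, since later only the spans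
  are compared.\<close>

definition unimodular_eigensystem :: "('a::complex_hilbert_space \<Rightarrow> 'a) \<Rightarrow> 'a set \<Rightarrow> bool" where
  "unimodular_eigensystem T S \<longleftrightarrow> finite S \<and>
     (\<forall>s\<in>S. norm s = 1 \<and> (\<exists>c. cmod c = 1 \<and> T s = c *\<^sub>C s)) \<and>
     (\<forall>s\<in>S. \<forall>t\<in>S. s \<noteq> t \<longrightarrow> cinner s t = 0)"

text \<open>One Gram-Schmidt step. The equality of spans keeps the orthonormal vectors on the given
  flag.\<close>

lemma orthonormal_insert:
  assumes "finite S" and nrm: "\<And>s. s \<in> S \<Longrightarrow> norm s = 1"
    and orth: "\<And>s t. \<lbrakk>s \<in> S; t \<in> S; s \<noteq> t\<rbrakk> \<Longrightarrow> cinner s t = 0"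
    and e: "e \<notin> cspan S"
  obtains u where "norm u = 1" "\<And>s. s \<in> S \<Longrightarrow> cinner u s = 0" "u \<notin> cspan S"
    "cspan (insert u S) = cspan (insert e S)"
proof -
  \<comment> \<open>\<open>w\<close> is the orthogonal projection of \<open>e\<close> onto the span
    of \<open>S\<close>.\<close>
  define w where "w = (\<Sum>s\<in>S. cinner e s *\<^sub>C s)"
  have w: "w \<in> cspan S"
    unfolding w_def by (intro complex_vec.span_sum complex_vec.span_scale complex_vec.span_base)
  define v where "v = e - w"
  have v: "v \<notin> cspan S"
    using e w complex_vec.span_add[of v S w] by (auto simp: v_def)
  then have v0: "v \<noteq> 0"
    using complex_vec.span_zero by blast
  have v_orth: "cinner v t = 0" if "t \<in> S" for t
  proof -
    have "cinner w t = (\<Sum>s\<in>S. if s = t then cinner e t else 0)"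
      unfolding w_def cinner_sum_left
      by (intro sum.cong) (auto simp: cinner_scaleC_left orth that cinner_self nrm)
    then show ?thesis
      using that assms(1) by (simp add: v_def cinner_diff_left)
  qed
  define k where "k = complex_of_real (1 / norm v)"
  have k: "k \<noteq> 0"
    using v0 by (simp add: k_def)
  define u where "u = k *\<^sub>C v"
  have vu: "v = (1 / k) *\<^sub>C u"
    using k by (simp add: u_def scaleC_scaleC scaleC_one)
  show thesis
  proof (rule that)
    show "norm u = 1"
      using v0 by (simp add: u_def norm_scaleC k_def norm_divide)
    show "cinner u s = 0" if "s \<in> S" for s
      by (simp add: u_def cinner_scaleC_left v_orth that)
    show "u \<notin> cspan S"
      using v vu complex_vec.span_scale by metis
    have "cspan (insert v S) = cspan (insert e S)"
      by (rule complex_vec.eq_span_insert_eq)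
        (use w complex_vec.span_neg[OF w] in \<open>simp add: v_def\<close>)
    moreover have "cspan (insert u S) = cspan (insert v S)"
      unfolding complex_vec.span_eq
    proof (intro conjI insert_subsetI)
      show "u \<in> cspan (insert v S)"
        unfolding u_def by (intro complex_vec.span_scale complex_vec.span_base) simp
      show "v \<in> cspan (insert u S)"
        by (subst vu, intro complex_vec.span_scale complex_vec.span_base) simp
    qed (auto intro: complex_vec.span_base)
    ultimately show "cspan (insert u S) = cspan (insert e S)"
      by simp
  qed
qed

lemma eigenvalue_in_spectrum:
  assumes "bounded_clinear T" and "T s = c *\<^sub>C s" and "s \<noteq> 0"
  shows "c \<in> spectrum T"
proof -
  have "\<not> invertible_operator (\<lambda>x. T x - c *\<^sub>C x)"
  proof
    assume "invertible_operator (\<lambda>x. T x - c *\<^sub>C x)"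
    then obtain R where R: "bounded_clinear R" "R \<circ> (\<lambda>x. T x - c *\<^sub>C x) = id"
      by (auto simp: invertible_operator_def)
    then have "R (T s - c *\<^sub>C s) = s"
      by (metis comp_apply id_apply)
    then show False
      using assms bounded_clinearD(5)[OF R(1)] by simp
  qed
  then show ?thesis
    by (simp add: spectrum_def)
qed

text \<open>
  A diagonal entry off the spectrum is impossible: \<open>T - c\<close> would map the span of \<open>S\<close> onto
  itself and also send a vector outside of the span into it.
\<close>

lemma diagonal_entry_in_spectrum:
  assumes T: "bounded_clinear T" and S: "unimodular_eigensystem T S"
    and u: "u \<notin> cspan S" and Tu: "T u - c *\<^sub>C u \<in> cspan S"
  shows "c \<in> spectrum T"
proof (rule ccontr)
  assume c: "c \<notin> spectrum T"
  let ?R = "\<lambda>x. T x - c *\<^sub>C x"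
  note R = bounded_clinearD[OF bounded_clinear_diff_scaleC[OF T, of c]]
  have "inj ?R"
  proof -
    obtain Q where "Q \<circ> ?R = id"
      using c by (auto simp: spectrum_def invertible_operator_def)
    then show ?thesis
      by (metis inj_on_id inj_on_imageI2)
  qed
  moreover have "cspan S \<subseteq> ?R ` cspan S"
  proof (rule complex_vec.span_minimal)
    show "S \<subseteq> ?R ` cspan S"
    proof
      fix s assume s: "s \<in> S"
      then obtain d where d: "T s = d *\<^sub>C s" "s \<noteq> 0"
        using S by (force simp: unimodular_eigensystem_def)
      \<comment> \<open>\<open>d\<close> lies in the spectrum and \<open>c\<close> does not, so
        \<open>s\<close> is the image of its multiple by \<open>1 / (d - c)\<close>.\<close>
      have "d \<noteq> c"
        using eigenvalue_in_spectrum[OF T d] c by auto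
      then have "s = (1 / (d - c)) *\<^sub>C ((d - c) *\<^sub>C s)"
        by (simp add: scaleC_scaleC scaleC_one)
      also have "(d - c) *\<^sub>C s = ?R s"
        using d by (simp add: complex_vec.scale_left_diff_distrib)
      also have "(1 / (d - c)) *\<^sub>C ?R s = ?R ((1 / (d - c)) *\<^sub>C s)"
        by (rule R(2)[symmetric])
      finally show "s \<in> ?R ` cspan S"
        using s by (blast intro: complex_vec.span_scale complex_vec.span_base)
    qed
    show "complex_vec.subspace (?R ` cspan S)"
    proof (rule complex_vec.subspaceI)
      show "0 \<in> ?R ` cspan S"
        using R(5) complex_vec.span_zero by (metis (no_types, lifting) image_eqI)
      show "x + y \<in> ?R ` cspan S" if xy: "x \<in> ?R ` cspan S" "y \<in> ?R ` cspan S" for x y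
      proof -
        obtain a b where "x = ?R a" "y = ?R b" "a \<in> cspan S" "b \<in> cspan S"
          using xy by blast
        then show ?thesis
          using R(3)[of a b] complex_vec.span_add[of a S b] by (metis (no_types, lifting) image_eqI)
      qed
      show "k *\<^sub>C x \<in> ?R ` cspan S" if x: "x \<in> ?R ` cspan S" for k x
      proof -
        obtain a where "x = ?R a" "a \<in> cspan S"
          using x by blast
        then show ?thesis
          using R(2)[of k a] complex_vec.span_scale[of a S k] by (metis (no_types, lifting) image_eqI)
      qed
    qed
  qed
  ultimately show False
    using u Tu inj_image_mem_iff[of ?R u "cspan S"] by blast
qed

text \<open>For the new unit vector \<open>u\<close>, \<open>T u\<close> is
  \<open>c *\<^sub>C u\<close> plus a rest \<open>w\<close> in the span of \<open>S\<close>, hence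
  orthogonal to \<open>u\<close>. The diagonal entry \<open>c\<close> is unimodular, so Pythagoras
  and \<open>norm (T u) \<le> 1\<close> force \<open>w = 0\<close>.\<close>

lemma unimodular_eigensystem_extend:
  assumes T: "bounded_clinear T" and contr: "\<And>x. norm (T x) \<le> norm x"
    and spec: "spectrum T \<subseteq> sphere 0 1"
    and S: "unimodular_eigensystem T S"
    and inv: "T ` cspan (insert e S) \<subseteq> cspan (insert e S)"
  obtains S' where "unimodular_eigensystem T S'" "cspan S' = cspan (insert e S)"
proof (cases "e \<in> cspan S")
  case True
  then show thesis
    using that[OF S] complex_vec.span_redundant by metis
next
  case False
  obtain u where u: "norm u = 1" "\<And>s. s \<in> S \<Longrightarrow> cinner u s = 0" "u \<notin> cspan S"
    and span: "cspan (insert u S) = cspan (insert e S)"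
    using orthonormal_insert[OF _ _ _ False] S unfolding unimodular_eigensystem_def by metis
  have "T u \<in> cspan (insert u S)"
    using inv span complex_vec.span_base[of u "insert u S"] by auto
  then obtain c where c: "T u - c *\<^sub>C u \<in> cspan S"
    by (auto simp: complex_vec.span_breakdown_eq)
  have c1: "cmod c = 1"
    using diagonal_entry_in_spectrum[OF T S u(3) c] spec by auto
  define w where "w = T u - c *\<^sub>C u"
  have "cinner u w = 0"
    using cinner_span_right_eq_0[OF c] u(2) by (simp add: w_def)
  then have "inner (c *\<^sub>C u) w = 0"
    by (simp add: Re_cinner[symmetric] cinner_scaleC_left)
  then have "(norm (c *\<^sub>C u + w))\<^sup>2 = (norm (c *\<^sub>C u))\<^sup>2 + (norm w)\<^sup>2"
    by (intro norm_add_Pythagorean) (simp add: orthogonal_def)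
  moreover have "norm (c *\<^sub>C u + w) \<le> 1"
    using contr[of u] u(1) by (simp add: w_def)
  ultimately have "1 + (norm w)\<^sup>2 \<le> 1"
    using c1 u(1) by (metis norm_scaleC mult_1 norm_ge_zero one_power2 power_mono)
  then have "T u = c *\<^sub>C u"
    by (simp add: w_def)
  moreover have "cinner s u = 0" if "s \<in> S" for s
    using u(2)[OF that] by (metis cinner_commute complex_cnj_zero)
  ultimately have "unimodular_eigensystem T (insert u S)"
    using S u(1,2) c1 unfolding unimodular_eigensystem_def by auto
  then show thesis
    using that span by blast
qed

text \<open>Orthogonal eigenvectors with unimodular eigenvalues keep their inner products under
  \<open>T\<close>; linearity extends this to the span, one argument at a time.\<close>

lemma unimodular_eigensystem_isometric:
  assumes T: "bounded_clinear T" and S: "unimodular_eigensystem T S" and x: "x \<in> cspan S"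
  shows "norm (T x) = norm x"
proof -
  note T_simps = bounded_clinearD[OF T]
  have ss: "cinner (T s) (T t) = cinner s t" if "s \<in> S" "t \<in> S" for s t
  proof -
    have "\<exists>c. cmod c = 1 \<and> T s = c *\<^sub>C s" if "s \<in> S" for s
      using S that by (simp add: unimodular_eigensystem_def)
    from this[OF \<open>s \<in> S\<close>] this[OF \<open>t \<in> S\<close>]
    obtain c d where "T s = c *\<^sub>C s" "T t = d *\<^sub>C t" "cmod c = 1"
      by blast
    moreover have "cnj c * c = 1" if "cmod c = 1" for c
      using that by (simp add: complex_norm_square[symmetric] mult.commute)
    moreover have "cinner s t = 0" if "s \<noteq> t"
      using S that \<open>s \<in> S\<close> \<open>t \<in> S\<close> by (simp add: unimodular_eigensystem_def)
    ultimately show ?thesis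
      by (cases "s = t") (auto simp: cinner_scaleC_left cinner_scaleC_right mult.assoc[symmetric])
  qed
  have xs: "cinner (T x) (T t) = cinner x t" if "x \<in> cspan S" "t \<in> S" for x t
    using that(1)
  proof (induction rule: complex_vec.span_induct)
    case base
    show ?case
      by (rule complex_vec.subspaceI) (auto simp: T_simps cinner_add_left cinner_scaleC_left)
  qed (rule ss[OF _ that(2)])
  have "cinner (T x) (T y) = cinner x y" if "y \<in> cspan S" for y
    using that
  proof (induction rule: complex_vec.span_induct)
    case base
    show ?case
      by (rule complex_vec.subspaceI) (auto simp: T_simps cinner_add_right cinner_scaleC_right)
  qed (rule xs[OF x])
  then show ?thesis
    using x by (metis Re_cinner norm_eq_sqrt_inner)
qed

text \<open>Each stage of the flag is spanned by an eigensystem, so \<open>T\<close> is isometric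
  there. The partial sums of a basis expansion lie in these stages, and continuity passes to the
  limit.\<close>

lemma triangularizable_contraction_isometric:
  assumes T: "bounded_clinear T" and contr: "\<And>x. norm (T x) \<le> norm x"
    and spec: "spectrum T \<subseteq> sphere 0 1" and tri: "triangularizable T"
  shows "norm (T x) = norm x"
proof -
  obtain I e where basis: "hilbert_basis I e"
    and flag: "\<And>N. T ` cspan (e ` (I \<inter> {..N})) \<subseteq> cspan (e ` (I \<inter> {..N}))"
    using tri by (auto simp: triangularizable_def)
  \<comment> \<open>The strict bound starts the induction at the zero subspace; stage
    \<open>Suc N\<close> is the flag member for \<open>{..N}\<close>.\<close>
  have ex: "\<exists>S. unimodular_eigensystem T S \<and> cspan S = cspan (e ` (I \<inter> {..<N}))" for N
  proof (induction N)
    case 0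
    then show ?case
      by (intro exI[of _ "{}"]) (simp add: unimodular_eigensystem_def)
  next
    case (Suc N)
    then obtain S where S: "unimodular_eigensystem T S" "cspan S = cspan (e ` (I \<inter> {..<N}))"
      by blast
    show ?case
    proof (cases "N \<in> I")
      case True
      then have "e ` (I \<inter> {..<Suc N}) = insert (e N) (e ` (I \<inter> {..<N}))"
        by (auto simp: less_Suc_eq)
      then have span: "cspan (e ` (I \<inter> {..<Suc N})) = cspan (insert (e N) S)"
        by (simp add: complex_vec.span_insert S(2))
      then have "T ` cspan (insert (e N) S) \<subseteq> cspan (insert (e N) S)"
        using flag[of N] by (simp add: lessThan_Suc_atMost)
      then show ?thesis
        using unimodular_eigensystem_extend[OF T contr spec S(1)] span by metis
    next
      \<comment> \<open>Here \<open>I\<close> is a finite initial segment that ends before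
        \<open>N\<close>, and the stage no longer grows.\<close>
      case False
      then have "I \<inter> {..<Suc N} = I \<inter> {..<N}"
        by (auto simp: less_Suc_eq)
      then show ?thesis
        using S by auto
    qed
  qed
  obtain c where c: "\<And>n. n \<notin> I \<Longrightarrow> c n = 0" "(\<lambda>n. c n *\<^sub>C e n) sums x"
    using basis unfolding hilbert_basis_def by metis
  define X where "X = (\<lambda>N. \<Sum>n<N. c n *\<^sub>C e n)"
  have X: "X \<longlonglongrightarrow> x"
    using c(2) by (simp add: X_def sums_def)
  have "norm (T (X N)) = norm (X N)" for N
  proof -
    have "X N \<in> cspan (e ` (I \<inter> {..<N}))"
      unfolding X_def
    proof (rule complex_vec.span_sum)
      show "c n *\<^sub>C e n \<in> cspan (e ` (I \<inter> {..<N}))" if "n \<in> {..<N}" for n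
      proof (cases "n \<in> I")
        case True
        then show ?thesis
          using that by (intro complex_vec.span_scale complex_vec.span_base) auto
      qed (simp add: c(1) complex_vec.span_zero)
    qed
    then show ?thesis
      using ex[of N] unimodular_eigensystem_isometric[OF T] by metis
  qed
  moreover have "(\<lambda>N. norm (T (X N))) \<longlonglongrightarrow> norm (T x)"
    by (intro tendsto_norm bounded_linear.tendsto[OF bounded_clinearD(1)[OF T]] X)
  ultimately show ?thesis
    using tendsto_norm[OF X] LIMSEQ_unique by auto
qed

section \<open>The Schwarz lemma in the unit ball\<close>

lemma holomorphic_map_on_compose:
  assumes "holomorphic_map_on g S" "holomorphic_map_on f T" "g ` S \<subseteq> T"
  shows "holomorphic_map_on (f \<circ> g) S"
  unfolding holomorphic_map_on_def
proof
  fix q assume "q \<in> S"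
  with assms obtain D E where "bounded_clinear D" "(g has_derivative D) (at q)"
    and "bounded_clinear E" "(f has_derivative E) (at (g q))"
    unfolding holomorphic_map_on_def by blast
  then show "\<exists>D. bounded_clinear D \<and> (f \<circ> g has_derivative D) (at q)"
    by (intro exI[of _ "E \<circ> D"] conjI bounded_clinear_compose diff_chain_at)
qed

lemma bounded_clinear_imp_holomorphic: "bounded_clinear T \<Longrightarrow> holomorphic_map_on T S"
  unfolding holomorphic_map_on_def
  by (blast intro: bounded_clinearD(1) bounded_linear_imp_has_derivative)

text \<open>As \<open>D\<close> is complex linear, the real derivative of the slice is
  multiplication by one complex number, which opens the way to one-variable function theory.\<close>

lemma has_field_derivative_cinner_slice:
  assumes h: "(h has_derivative D) (at (z *\<^sub>C x))" and D: "bounded_clinear D"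
  shows "((\<lambda>z. cinner (h (z *\<^sub>C x)) y) has_field_derivative cinner (D x) y) (at z)"
proof -
  have "((\<lambda>z. z *\<^sub>C x) has_derivative (\<lambda>z. z *\<^sub>C x)) (at z)"
    by (rule bounded_linear_imp_has_derivative[OF bounded_linear_scaleC_left])
  from diff_chain_at[OF this h]
  have "((\<lambda>z. h (z *\<^sub>C x)) has_derivative (\<lambda>t. D (t *\<^sub>C x))) (at z)"
    by (simp add: o_def)
  from bounded_linear.has_derivative[OF bounded_linear_cinner_left this]
  show ?thesis
    by (simp add: has_field_derivative_def bounded_clinearD[OF D] cinner_scaleC_left
        mult_commute_abs)
qed

text \<open>Identifies the directional limit with the Frechet derivative, so that the chain rule
  applies to differentials. Restriction to the complex line through \<open>q\<close> along
  \<open>v\<close> reduces it to a derivative at 0 in the plane.\<close>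

lemma cdifferential_eq:
  assumes g: "(g has_derivative D) (at q)" and D: "bounded_clinear D"
  shows "cdifferential g q = D"
proof
  fix v
  have "((\<lambda>h. q + h *\<^sub>C v) has_derivative (\<lambda>h. h *\<^sub>C v)) (at 0)"
    by (intro has_derivative_add_const[where c = q, simplified add.commute]
        bounded_linear_imp_has_derivative bounded_linear_scaleC_left)
  then have "((\<lambda>h. g (q + h *\<^sub>C v)) has_derivative (\<lambda>h. D (h *\<^sub>C v))) (at 0)"
    using diff_chain_at[of "\<lambda>h. q + h *\<^sub>C v" _ 0 g D] g by (simp add: o_def)
  then have lim: "((\<lambda>h. norm (g (q + h *\<^sub>C v) - g q - h *\<^sub>C D v) / cmod h) \<longlongrightarrow> 0) (at 0)"
    by (simp add: has_derivative_iff_norm bounded_clinearD[OF D])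
  have "((\<lambda>h. (1 / h) *\<^sub>C (g (q + h *\<^sub>C v) - g q) - D v) \<longlongrightarrow> 0) (at 0)"
  proof (rule Lim_transform_eventually[OF _ _, THEN tendsto_norm_zero_cancel])
    show "((\<lambda>h. norm (g (q + h *\<^sub>C v) - g q - h *\<^sub>C D v) / cmod h) \<longlongrightarrow> 0) (at 0)"
      by (fact lim)
    have "norm (g (q + h *\<^sub>C v) - g q - h *\<^sub>C D v) / cmod h
        = norm ((1 / h) *\<^sub>C (g (q + h *\<^sub>C v) - g q) - D v)" if "h \<noteq> 0" for h
    proof -
      have "(1 / h) *\<^sub>C (g (q + h *\<^sub>C v) - g q) - D v
          = (1 / h) *\<^sub>C (g (q + h *\<^sub>C v) - g q - h *\<^sub>C D v)"
        using that by (simp add: complex_vec.scale_right_diff_distrib scaleC_scaleC scaleC_one)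
      then show ?thesis
        by (simp add: norm_scaleC norm_divide)
    qed
    then show "\<forall>\<^sub>F h in at 0. norm (g (q + h *\<^sub>C v) - g q - h *\<^sub>C D v) / cmod h
        = norm ((1 / h) *\<^sub>C (g (q + h *\<^sub>C v) - g q) - D v)"
      by (auto simp: eventually_at_filter)
  qed
  then have "((\<lambda>h. (1 / h) *\<^sub>C (g (q + h *\<^sub>C v) - g q)) \<longlongrightarrow> D v) (at 0)"
    using Lim_null by blast
  then show "cdifferential g q v = D v"
    unfolding cdifferential_def by (intro tendsto_Lim) auto
qed

lemma cdifferential_works:
  assumes "holomorphic_map_on g S" "q \<in> S"
  shows "bounded_clinear (cdifferential g q)" "(g has_derivative cdifferential g q) (at q)"
  using assms cdifferential_eq unfolding holomorphic_map_on_def by metis+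

section \<open>Self-maps of the ball fixing the origin: contraction and rigidity\<close>

locale ball_self_map_fixing_0 =
  fixes h D :: "'a::complex_hilbert_space \<Rightarrow> 'a"
  assumes holo: "holomorphic_map_on h unit_ball"
    and maps: "h ` unit_ball \<subseteq> unit_ball"
    and h_0: "h 0 = 0"
    and deriv_0: "(h has_derivative D) (at 0)"
    and clinear: "bounded_clinear D"
begin

text \<open>Supplies the hypotheses of the one-variable Schwarz lemma for \<open>h\<close> on a disc
  through 0, tested against \<open>y\<close>.\<close>

lemma slice:
  assumes x: "norm x = 1" and y: "norm y \<le> 1"
  defines "\<phi> \<equiv> \<lambda>z. cinner (h (z *\<^sub>C x)) y"
  shows "\<phi> holomorphic_on ball 0 1" "\<phi> 0 = 0" "\<And>z. cmod z < 1 \<Longrightarrow> cmod (\<phi> z) < 1"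
    "deriv \<phi> 0 = cinner (D x) y"
proof -
  have in_ball: "z *\<^sub>C x \<in> unit_ball" if "cmod z < 1" for z
    using that x by (simp add: norm_scaleC)
  show "\<phi> holomorphic_on ball 0 1"
  proof (rule holomorphic_onI)
    fix z :: complex assume "z \<in> ball 0 1"
    then obtain E where "bounded_clinear E" "(h has_derivative E) (at (z *\<^sub>C x))"
      using holo in_ball[of z] by (force simp: holomorphic_map_on_def)
    then have "\<phi> field_differentiable at z"
      unfolding \<phi>_def field_differentiable_def
      using has_field_derivative_cinner_slice by blast
    then show "\<phi> field_differentiable at z within ball 0 1"
      by (rule field_differentiable_at_within)
  qed
  show "\<phi> 0 = 0"
    by (simp add: \<phi>_def h_0)
  show "cmod (\<phi> z) < 1" if "cmod z < 1" for z
  proof -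
    have "cmod (\<phi> z) \<le> norm (h (z *\<^sub>C x)) * norm y"
      unfolding \<phi>_def by (rule cmod_cinner_le)
    also have "\<dots> \<le> norm (h (z *\<^sub>C x))"
      using y by (simp add: mult_left_le)
    also have "\<dots> < 1"
      using maps in_ball[OF that] by (auto simp: image_subset_iff)
    finally show ?thesis .
  qed
  show "deriv \<phi> 0 = cinner (D x) y"
    unfolding \<phi>_def
    by (rule DERIV_imp_deriv, rule has_field_derivative_cinner_slice)
      (simp_all add: deriv_0 clinear)
qed

text \<open>The derivative bound of the Schwarz lemma, for all test vectors in a unit direction,
  bounds \<open>D\<close> there; homogeneity does the rest.\<close>

lemma deriv_contraction: "norm (D x) \<le> norm x"
proof (cases "x = 0")
  case False
  define u where "u = complex_of_real (1 / norm x) *\<^sub>C x"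
  have u: "norm u = 1"
    using False by (simp add: u_def norm_scaleC norm_divide)
  have xu: "x = complex_of_real (norm x) *\<^sub>C u"
    using False by (simp add: u_def scaleC_scaleC scaleC_one)
  have "norm (D u) \<le> 1"
  proof (rule norm_le_if_cinner_le)
    fix y :: 'a assume y: "norm y = 1"
    note s = slice[OF u eq_refl[OF y]]
    show "cmod (cinner (D u) y) \<le> 1"
      using Schwarz_Lemma(2)[OF s(1-3), of 0] by (simp add: s(4))
  qed simp
  moreover have "norm (D x) = norm x * norm (D u)"
    by (subst xu, subst bounded_clinearD(2)[OF clinear]) (simp add: norm_scaleC)
  ultimately show ?thesis
    by (simp add: mult_left_le)
qed (simp add: bounded_clinearD[OF clinear])

text \<open>Testing against \<open>D u\<close> gives a slice with derivative 1 at 0, the extremal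
  case, so \<open>inner (h x) (D x)\<close> equals \<open>(norm x)\<^sup>2\<close>. With
  \<open>norm (h x) \<le> norm x\<close> this is equality in Cauchy-Schwarz.\<close>

lemma eq_deriv_if_isometric:
  assumes iso: "\<And>x. norm (D x) = norm x" and x: "x \<in> unit_ball"
  shows "h x = D x"
proof (cases "x = 0")
  case False
  define z where "z = complex_of_real (norm x)"
  define u where "u = complex_of_real (1 / norm x) *\<^sub>C x"
  have u: "norm u = 1"
    using False by (simp add: u_def norm_scaleC norm_divide)
  have xu: "x = z *\<^sub>C u"
    using False by (simp add: u_def z_def scaleC_scaleC scaleC_one)
  have z: "cmod z < 1" "cmod z = norm x"
    using x by (simp_all add: z_def)
  have "norm (h x) \<le> norm x"
  proof (rule norm_le_if_cinner_le)
    fix y :: 'a assume y: "norm y = 1"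
    note s = slice[OF u eq_refl[OF y]]
    show "cmod (cinner (h x) y) \<le> norm x"
      using Schwarz_Lemma(1)[OF s(1-3) z(1)] by (simp add: xu[symmetric] z(2))
  qed simp
  have Du: "norm (D u) = 1"
    by (simp add: iso u)
  note s = slice[OF u eq_refl[OF Du]]
  have d: "deriv (\<lambda>z. cinner (h (z *\<^sub>C u)) (D u)) 0 = 1"
    by (simp add: s(4) cinner_self Du)
  then have "cmod (deriv (\<lambda>z. cinner (h (z *\<^sub>C u)) (D u)) 0) = 1"
    by simp
  then obtain a where a: "\<And>w. cmod w < 1 \<Longrightarrow> cinner (h (w *\<^sub>C u)) (D u) = a * w"
    using Schwarz_Lemma(3)[OF s(1-3), of 0] by auto
  \<comment> \<open>The extremal case yields linearity with an unknown slope \<open>a\<close>;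
    comparing derivatives at 0 gives \<open>a = 1\<close>.\<close>
  have "((\<lambda>w. a * w) has_field_derivative a) (at 0)"
    by (auto intro!: derivative_eq_intros)
  then have "((\<lambda>w. cinner (h (w *\<^sub>C u)) (D u)) has_field_derivative a) (at 0)"
    by (rule has_field_derivative_transform_within_open[of _ _ _ "ball 0 1"]) (auto simp: a)
  then have "a = 1"
    using d DERIV_imp_deriv by metis
  then have "cinner (h x) (D u) = z"
    using a[OF z(1)] by (simp add: xu[symmetric])
  then have "cinner (h x) (D x) = of_real ((norm x)\<^sup>2)"
    by (subst (2) xu)
      (simp add: bounded_clinearD[OF clinear] cinner_scaleC_right z_def power2_eq_square)
  then have "inner (h x) (D x) = (norm x)\<^sup>2"
    by (simp add: Re_cinner[symmetric])
  moreover have "inner (D x) (D x) = inner x x"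
    using iso[of x] by (simp add: norm_eq_sqrt_inner)
  \<comment> \<open>The mixed term contributes \<open>- 2 * (norm x)\<^sup>2\<close>, and
    \<open>D x\<close> gives one \<open>(norm x)\<^sup>2\<close> back.\<close>
  ultimately have "(norm (h x - D x))\<^sup>2 = (norm (h x))\<^sup>2 - (norm x)\<^sup>2"
    by (simp add: power2_norm_eq_inner inner_diff inner_commute)
  also have "\<dots> \<le> 0"
    using \<open>norm (h x) \<le> norm x\<close> by (simp add: power_mono)
  finally show ?thesis
    by simp
qed (simp add: h_0 bounded_clinearD[OF clinear])

end

text \<open>\<open>inv_into S f\<close> is known to agree with \<open>g\<close> on \<open>S\<close>
  only; openness of \<open>S\<close> carries the derivative over.\<close>

lemma biholomorphic_self_mapI:
  assumes "open S" and f: "holomorphic_map_on f S" "f ` S \<subseteq> S"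
    and g: "holomorphic_map_on g S" "g ` S \<subseteq> S"
    and gf: "\<And>x. x \<in> S \<Longrightarrow> g (f x) = x" and fg: "\<And>y. y \<in> S \<Longrightarrow> f (g y) = y"
  shows "biholomorphic_self_map f S"
  unfolding biholomorphic_self_map_def
proof (intro conjI f)
  show bij: "bij_betw f S S"
    using f g gf fg by (intro bij_betw_byWitness[where f' = g]) auto
  have eq: "inv_into S f y = g y" if "y \<in> S" for y
    using that bij g fg by (intro inv_into_f_eq) (auto simp: bij_betw_def)
  show "holomorphic_map_on (inv_into S f) S"
    unfolding holomorphic_map_on_def
  proof
    fix q assume q: "q \<in> S"
    then obtain D where D: "bounded_clinear D" "(g has_derivative D) (at q)"
      using g by (auto simp: holomorphic_map_on_def)
    have "(inv_into S f has_derivative D) (at q)"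
      by (rule has_derivative_transform_within_open[OF D(2) \<open>open S\<close> q]) (simp add: eq)
    with D show "\<exists>D. bounded_clinear D \<and> (inv_into S f has_derivative D) (at q)"
      by blast
  qed
qed

section \<open>Conjugation to a linear isometry and inversion\<close>

theorem proposition3p1:
  fixes f M U :: "'a::complex_hilbert_space \<Rightarrow> 'a"
    and p :: 'a
  assumes separable: "separable_space (euclidean :: 'a topology)"
    and f_maps: "f ` unit_ball \<subseteq> unit_ball"
    and f_holo: "holomorphic_map_on f unit_ball"
    and p: "p \<in> unit_ball"
    and M_moebius: "biholomorphic_self_map M unit_ball"
    and M_p: "M p = 0"
    and f_p: "f p = p"
    and U: "unitary U"
    and i: "triangularizable
      (U \<circ> cdifferential M p \<circ> cdifferential f p \<circ> cdifferential (inv_into unit_ball M) 0)"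
    and ii: "spectrum
      (U \<circ> cdifferential M p \<circ> cdifferential f p \<circ> cdifferential (inv_into unit_ball M) 0)
        \<subseteq> sphere 0 1"
  shows "biholomorphic_self_map f unit_ball"
proof -
  define N where "N = inv_into unit_ball M"
  define T where "T = U \<circ> cdifferential M p \<circ> cdifferential f p \<circ> cdifferential N 0"
  define h where "h = U \<circ> M \<circ> f \<circ> N"
  have bij: "bij_betw M unit_ball unit_ball" and M_holo: "holomorphic_map_on M unit_ball"
    and N_holo: "holomorphic_map_on N unit_ball"
    using M_moebius by (auto simp: biholomorphic_self_map_def N_def)
  have NM: "N (M x) = x" if "x \<in> unit_ball" for x
    using bij that by (simp add: N_def bij_betw_inv_into_left)
  have MN: "M (N y) = y" if "y \<in> unit_ball" for y
    using bij that by (simp add: N_def bij_betw_inv_into_right)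
  have M_maps: "M ` unit_ball \<subseteq> unit_ball"
    using bij by (simp add: bij_betw_def)
  have N_maps: "N ` unit_ball \<subseteq> unit_ball"
    using bij_betw_inv_into[OF bij] by (simp add: N_def bij_betw_def)
  have N_0: "N 0 = p"
    using NM[OF p] M_p by simp
  have U_lin: "bounded_clinear U"
    using U by (simp add: unitary_def)
  have U_inj: "x = y" if "U x = U y" for x y
    using that unitary_norm[OF U, of "x - y"] by (simp add: bounded_clinearD[OF U_lin])
  have U_maps: "U ` unit_ball \<subseteq> unit_ball"
    using unitary_norm[OF U] by auto
  have "0 \<in> (unit_ball :: 'a set)"
    by simp
  note dM = cdifferential_works[OF M_holo p]
    and df = cdifferential_works[OF f_holo p]
    and dN = cdifferential_works[OF N_holo this]
  have T_lin: "bounded_clinear T"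
    unfolding T_def by (intro bounded_clinear_compose U_lin dM df dN)
  interpret ball_self_map_fixing_0 h T
  proof
    show "holomorphic_map_on h unit_ball"
      unfolding h_def comp_assoc
      using f_maps M_maps N_maps
      by (intro holomorphic_map_on_compose[where T = unit_ball] f_holo M_holo N_holo
          bounded_clinear_imp_holomorphic U_lin) (auto simp: image_subset_iff)
    show "h ` unit_ball \<subseteq> unit_ball"
      using f_maps M_maps N_maps U_maps unfolding h_def comp_def by blast
    show "h 0 = 0"
      by (simp add: h_def N_0 f_p M_p bounded_clinearD[OF U_lin])
    \<comment> \<open>The chain rule follows the base points \<open>N 0 = p\<close>,
      \<open>f p = p\<close> and \<open>M p = 0\<close>, where the factors of \<open>T\<close> are
      taken.\<close>
    have "(U has_derivative U) (at (M p))"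
      by (rule bounded_linear_imp_has_derivative[OF bounded_clinearD(1)[OF U_lin]])
    then show "(h has_derivative T) (at 0)"
      unfolding h_def T_def using dM dN df
      by (intro diff_chain_at) (simp_all add: N_0 f_p)
  qed (fact T_lin)
  have iso: "norm (T x) = norm x" for x
    by (rule triangularizable_contraction_isometric[OF T_lin deriv_contraction])
      (use i ii in \<open>simp_all only: T_def N_def\<close>)
  have hT: "U (M (f (N y))) = T y" if "y \<in> unit_ball" for y
    using eq_deriv_if_isometric[OF iso that] by (simp add: h_def)
  have "0 \<notin> spectrum T"
    using ii by (auto simp: T_def N_def)
  then obtain R where R_lin: "bounded_clinear R" and RT: "\<And>x. R (T x) = x" and TR: "\<And>x. T (R x) = x"
    by (auto simp: spectrum_def invertible_operator_def fun_eq_iff)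
  have R_maps: "R ` unit_ball \<subseteq> unit_ball"
    using iso TR by (metis (no_types, lifting) dist_0_norm image_subsetI mem_ball)
  \<comment> \<open>Obtained by solving \<open>U \<circ> M \<circ> f \<circ> N = T\<close> for the
    inverse of \<open>f\<close>.\<close>
  define g where "g = N \<circ> R \<circ> U \<circ> M"
  show ?thesis
  proof (rule biholomorphic_self_mapI)
    show "holomorphic_map_on g unit_ball"
      unfolding g_def comp_assoc
      using U_maps M_maps R_maps
      by (intro holomorphic_map_on_compose[where T = unit_ball] M_holo N_holo
          bounded_clinear_imp_holomorphic U_lin R_lin) (auto simp: image_subset_iff)
    show "g ` unit_ball \<subseteq> unit_ball"
      using R_maps M_maps N_maps U_maps unfolding g_def comp_def by blast
    show "g (f x) = x" if "x \<in> unit_ball" for x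
    proof -
      have "M x \<in> unit_ball"
        using that M_maps by blast
      from hT[OF this] show ?thesis
        using that by (simp add: g_def NM RT)
    qed
    show "f (g y) = y" if y: "y \<in> unit_ball" for y
    proof -
      have z: "R (U (M y)) \<in> unit_ball"
        using y R_maps U_maps M_maps by blast
      \<comment> \<open>At \<open>R (U (M y))\<close> the identity \<open>hT\<close> has right-hand
        side \<open>U (M y)\<close>, and \<open>U\<close> cancels.\<close>
      have "M (f (g y)) = M y"
        using hT[OF z] U_inj by (simp add: g_def TR)
      moreover have "f (g y) \<in> unit_ball"
        using z N_maps f_maps unfolding g_def comp_def by blast
      ultimately show ?thesis
        using NM y by metis
    qed
  qed (use f_holo f_maps in auto)
qed

end
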